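(* The necessary condition for the existence of $N$-degree polynomial solutions of the differential equation $$(a_2z^2+a_1z)f''(z)+(b_2z^2+b_1z+b_0)f'(z)-(\tau_1 z+\tau_0)f(z)=0$$ is $$\tau_1=N\,b_2,\qquad N=0,1,2,\dots,$$ and the polynomial solutions are given explicitly by $$f_N(z)=\sum_{k=0}^N \frac{P_k(\tau_0)}{k!\,a_1^k\,(b_0/a_1)_k}\,z^k ,$$ where, for each $N$, the finite sequence of polynomials $\{P_k(\tau_0)\}_{k=0}^N$ satisfies the three-term recurrence relation, for $0\le k\le N+1$, $$P_{k+1}(\tau_0)=\bigl(\tau_0-k(k-1)a_2-kb_1\bigr)P_k(\tau_0)+k\,b_2\,(N-k+1)\bigl((k-1)a_1+b_0\bigr)P_{k-1}(\tau_0),$$ initialized with $P_{-1}(\tau_0)=0$ and $P_0(\tau_0)=1$.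
   Context: Here $a_1,a_2,b_0,b_1,b_2,\tau_0,\tau_1$ are the constant coefficients of the differential equation, $f$ is the unknown function of $z$, and $(x)_k$ denotes the Pochhammer symbol: $(x)_k=x(x+1)\cdots(x+k-1)=\Gamma(x+k)/\Gamma(x)$, with $(x)_0=1$. *)

theory Defs
  imports "HOL-Analysis.Analysis" "HOL-Computational_Algebra.Polynomial"
begin

definition solves_ode ::
    "'a::real_normed_field \<Rightarrow> 'a \<Rightarrow> 'a \<Rightarrow> 'a \<Rightarrow> 'a \<Rightarrow> 'a \<Rightarrow> 'a \<Rightarrow> ('a \<Rightarrow> 'a) \<Rightarrow> bool" where
  "solves_ode a1 a2 b0 b1 b2 \<tau>0 \<tau>1 f \<longleftrightarrow>
     (\<forall>z. (a2 * z^2 + a1 * z) * deriv (deriv f) z + (b2 * z^2 + b1 * z + b0) * deriv f z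
          - (\<tau>1 * z + \<tau>0) * f z = 0)"

(* The condition p \<noteq> 0 matters only for N = 0, since the library sets degree 0 = 0. *)
definition poly_fun_of_degree :: "nat \<Rightarrow> ('a::real_normed_field \<Rightarrow> 'a) \<Rightarrow> bool" where
  "poly_fun_of_degree N f \<longleftrightarrow> (\<exists>p. p \<noteq> 0 \<and> degree p = N \<and> f = poly p)"

definition poly_solution ::
    "'a::real_normed_field \<Rightarrow> 'a \<Rightarrow> 'a \<Rightarrow> 'a \<Rightarrow> 'a \<Rightarrow> 'a \<Rightarrow> 'a \<Rightarrow> nat \<Rightarrow> ('a \<Rightarrow> 'a) \<Rightarrow> bool" where
  "poly_solution a1 a2 b0 b1 b2 \<tau>0 \<tau>1 N f \<longleftrightarrow>
     poly_fun_of_degree N f \<and> solves_ode a1 a2 b0 b1 b2 \<tau>0 \<tau>1 f"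

(* P is indexed by the integers so that P (-1) makes sense; each P k is a polynomial in the
   parameter t, which plays the role of \<tau>0. Only the values P (-1), ..., P (N + 2) are
   constrained. *)
definition recurrence_polys ::
    "'a::real_normed_field \<Rightarrow> 'a \<Rightarrow> 'a \<Rightarrow> 'a \<Rightarrow> 'a \<Rightarrow> nat \<Rightarrow> (int \<Rightarrow> 'a poly) \<Rightarrow> bool" where
  "recurrence_polys a1 a2 b0 b1 b2 N P \<longleftrightarrow>
     P (-1) = 0 \<and> P 0 = 1 \<and>
     (\<forall>k\<in>{0..int N + 1}. \<forall>t.
        poly (P (k + 1)) t =
          (t - of_int (k * (k - 1)) * a2 - of_int k * b1) * poly (P k) t
          + of_int k * b2 * of_int (int N - k + 1) * (of_int (k - 1) * a1 + b0) * poly (P (k - 1)) t)"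

definition explicit_solution ::
    "'a::real_normed_field \<Rightarrow> 'a \<Rightarrow> 'a \<Rightarrow> nat \<Rightarrow> (int \<Rightarrow> 'a poly) \<Rightarrow> 'a \<Rightarrow> 'a" where
  "explicit_solution a1 b0 \<tau>0 N P z =
     (\<Sum>k\<le>N. poly (P (int k)) \<tau>0 / (fact k * a1 ^ k * pochhammer (b0 / a1) k) * z ^ k)"

end

theory Submission
  imports Defs
begin

text \<open>
  Comparing coefficients turns the differential equation into a three-term recurrence for the
  coefficients of a polynomial solution. The equation at \<open>z^(N+1)\<close> involves only the leading
  coefficient and forces \<open>\<tau>1 = N b2\<close>; the equations below \<open>z^N\<close> determine all coefficients from the
  constant one, since \<open>j a1 + b0 \<noteq> 0\<close> for \<open>j < N\<close>. Clearing denominators in them gives the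
  recurrence for the polynomials \<open>P_k\<close>.
\<close>

lemma deriv_poly:
  fixes p :: "'a::real_normed_field poly"
  shows "deriv (poly p) = poly (pderiv p)"
  by (intro ext DERIV_imp_deriv poly_DERIV)

text \<open>A real normed field is infinite, so a polynomial that vanishes at every point is the
  zero polynomial. The pointwise equation thus becomes an identity whose coefficients can be
  compared.\<close>

lemma solves_ode_poly_iff:
  fixes p :: "'a::real_normed_field poly"
  shows "solves_ode a1 a2 b0 b1 b2 \<tau>0 \<tau>1 (poly p) \<longleftrightarrow>
    [:0, a1, a2:] * pderiv (pderiv p) + [:b0, b1, b2:] * pderiv p - [:\<tau>0, \<tau>1:] * p = 0"
    (is "_ \<longleftrightarrow> ?q = 0")
proof -
  have "solves_ode a1 a2 b0 b1 b2 \<tau>0 \<tau>1 (poly p) \<longleftrightarrow> (\<forall>z. poly ?q z = 0)"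
    unfolding solves_ode_def deriv_poly
    by (simp add: algebra_simps power2_eq_square)
  then show ?thesis
    by (simp only: poly_all_0_iff_0)
qed

text \<open>This is the equation at \<open>z^n\<close>: \<open>a1\<close> and \<open>b0\<close>
  contribute to \<open>coeff p (Suc n)\<close>, \<open>a2\<close>, \<open>b1\<close> and
  \<open>\<tau>0\<close> to \<open>coeff p n\<close>, \<open>b2\<close> and \<open>\<tau>1\<close>
  to \<open>coeff p (n - 1)\<close>. The conditional guards against truncated subtraction at
  \<open>n = 0\<close>.\<close>

lemma ode_coeff_recurrence:
  fixes p :: "'a::real_normed_field poly"
  assumes "solves_ode a1 a2 b0 b1 b2 \<tau>0 \<tau>1 (poly p)"
  shows "of_nat (Suc n) * (of_nat n * a1 + b0) * coeff p (Suc n) =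
      (\<tau>0 - of_nat n * (of_nat n - 1) * a2 - of_nat n * b1) * coeff p n
      + (if n = 0 then 0 else (\<tau>1 - (of_nat n - 1) * b2) * coeff p (n - 1))"
proof -
  have coeff_quad: "coeff ([:c0, c1, c2:] * q) n = c0 * coeff q n
      + (case n of 0 \<Rightarrow> 0 | Suc m \<Rightarrow> c1 * coeff q m + (case m of 0 \<Rightarrow> 0 | Suc l \<Rightarrow> c2 * coeff q l))"
    for c0 c1 c2 and q :: "'a poly"
    by (simp add: coeff_pCons split: nat.split)
  \<comment> \<open>The padding zero in \<open>[:\<tau>0, \<tau>1, 0:]\<close> gives the linear
    factor the three-entry shape to which \<open>coeff_quad\<close> applies.\<close>
  have "coeff ([:0, a1, a2:] * pderiv (pderiv p) + [:b0, b1, b2:] * pderiv p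
      - [:\<tau>0, \<tau>1, 0:] * p) n = 0"
    using assms by (simp add: solves_ode_poly_iff)
  then have eq: "coeff ([:0, a1, a2:] * pderiv (pderiv p)) n + coeff ([:b0, b1, b2:] * pderiv p) n
      = coeff ([:\<tau>0, \<tau>1, 0:] * p) n"
    by (simp only: coeff_add coeff_diff right_minus_eq)
  show ?thesis
  proof (cases n)
    case 0
    then show ?thesis
      using eq unfolding coeff_quad by (simp add: coeff_pderiv)
  next
    case (Suc m)
    show ?thesis
    proof (cases m)
      case 0
      with Suc show ?thesis
        using eq unfolding coeff_quad by (simp add: coeff_pderiv algebra_simps)
    next
      case (Suc l)
      with \<open>n = Suc m\<close> show ?thesis
        using eq unfolding coeff_quad by (simp add: coeff_pderiv algebra_simps)
    qed
  qed
qed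

lemma degree_condition:
  assumes "poly_solution a1 a2 b0 b1 b2 \<tau>0 \<tau>1 N f"
  shows "\<tau>1 = of_nat N * b2"
proof -
  obtain p where p: "p \<noteq> 0" "degree p = N" "solves_ode a1 a2 b0 b1 b2 \<tau>0 \<tau>1 (poly p)"
    using assms by (auto simp: poly_solution_def poly_fun_of_degree_def)
  \<comment> \<open>At \<open>n = Suc N\<close>, the coefficients with indices \<open>N + 1\<close>
    and \<open>N + 2\<close> vanish by the degree of \<open>p\<close>.\<close>
  have "(\<tau>1 - of_nat N * b2) * lead_coeff p = 0"
    using ode_coeff_recurrence[OF p(3), of "Suc N"] p(2) by (simp add: coeff_eq_0)
  with p(1) show ?thesis
    by simp
qed

text \<open>Witness for the recurrence, indexed by \<open>m = k - 1\<close>, so that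
  \<open>N - k + 1\<close> becomes \<open>N - m\<close>. The difference is taken in the integers
  because \<open>m\<close> may exceed \<open>N\<close>. The value at \<open>Suc 0\<close> is the
  step \<open>k = 0\<close>, where only the factor \<open>t\<close> survives.\<close>

fun rec_poly :: "'a::real_normed_field \<Rightarrow> 'a \<Rightarrow> 'a \<Rightarrow> 'a \<Rightarrow> 'a \<Rightarrow> nat \<Rightarrow> nat \<Rightarrow> 'a poly" where
  "rec_poly a1 a2 b0 b1 b2 N 0 = 1"
| "rec_poly a1 a2 b0 b1 b2 N (Suc 0) = [:0, 1:]"
| "rec_poly a1 a2 b0 b1 b2 N (Suc (Suc m)) =
     [:- (of_nat (Suc m * m) * a2) - of_nat (Suc m) * b1, 1:] * rec_poly a1 a2 b0 b1 b2 N (Suc m)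
     + smult (of_nat (Suc m) * b2 * of_int (int N - int m) * (of_nat m * a1 + b0))
         (rec_poly a1 a2 b0 b1 b2 N m)"

lemma recurrence_polys_exist: "\<exists>P. recurrence_polys a1 a2 b0 b1 b2 N P"
proof
  let ?P = "\<lambda>k::int. if k < 0 then 0 else rec_poly a1 a2 b0 b1 b2 N (nat k)"
  show "recurrence_polys a1 a2 b0 b1 b2 N ?P"
    unfolding recurrence_polys_def
  proof (intro conjI ballI allI)
    fix k :: int and t
    assume "k \<in> {0..int N + 1}"
    then obtain n where k: "k = int n"
      using nonneg_int_cases by auto
    show "poly (?P (k + 1)) t =
          (t - of_int (k * (k - 1)) * a2 - of_int k * b1) * poly (?P k) t
          + of_int k * b2 * of_int (int N - k + 1) * (of_int (k - 1) * a1 + b0) * poly (?P (k - 1)) t"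
    proof (cases n)
      case 0
      then show ?thesis by (simp add: k)
    next
      case (Suc m)
      have "nat (k + 1) = Suc (Suc m)" "nat k = Suc m" "nat (k - 1) = m"
        using k Suc by auto
      then show ?thesis
        using k Suc by (simp add: algebra_simps)
    qed
  qed auto
qed

text \<open>The recurrence at a natural index, with differences taken in the field to match the
  coefficient equations. The argument \<open>int n - 1\<close> stays an integer so that
  \<open>n = 0\<close> reaches \<open>P (-1)\<close>.\<close>

lemma recurrence_polysD:
  assumes "recurrence_polys a1 a2 b0 b1 b2 N P" "n \<le> Suc N"
  shows "poly (P (int (Suc n))) t =
      (t - of_nat n * (of_nat n - 1) * a2 - of_nat n * b1) * poly (P (int n)) t
      + of_nat n * b2 * (of_nat N - of_nat n + 1) * ((of_nat n - 1) * a1 + b0)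
        * poly (P (int n - 1)) t"
proof -
  have "int n \<in> {0..int N + 1}"
    using assms(2) by auto
  with assms(1) have "poly (P (int n + 1)) t =
      (t - of_int (int n * (int n - 1)) * a2 - of_int (int n) * b1) * poly (P (int n)) t
      + of_int (int n) * b2 * of_int (int N - int n + 1) * (of_int (int n - 1) * a1 + b0)
        * poly (P (int n - 1)) t"
    unfolding recurrence_polys_def by blast
  then show ?thesis
    by (simp add: add.commute)
qed

lemma coeff_poly_solution:
  fixes p :: "'a::real_normed_field poly"
  assumes P: "recurrence_polys a1 a2 b0 b1 b2 N P"
    and a1: "a1 \<noteq> 0"
    and nz: "\<And>k. k \<le> N \<Longrightarrow> pochhammer (b0 / a1) k \<noteq> 0"
    and ode: "solves_ode a1 a2 b0 b1 b2 \<tau>0 (of_nat N * b2) (poly p)"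
    and "k \<le> N"
  shows "coeff p k =
    coeff p 0 * (poly (P (int k)) \<tau>0 / (fact k * a1 ^ k * pochhammer (b0 / a1) k))"
proof -
  define D where "D k = fact k * a1 ^ k * pochhammer (b0 / a1) k" for k
  have D_nz: "D k \<noteq> 0" if "k \<le> N" for k
    using nz[OF that] a1 by (simp add: D_def)
  have D_0: "D 0 = 1"
    by (simp add: D_def)
  \<comment> \<open>\<open>a1 ^ k * pochhammer (b0 / a1) k\<close> is the product of
    \<open>j * a1 + b0\<close> over \<open>j < k\<close>, so \<open>D\<close> grows by exactly the
    factor on the left of the coefficient equation.\<close>
  have D_Suc: "D (Suc k) = of_nat (Suc k) * (of_nat k * a1 + b0) * D k" for k
    using a1 by (simp add: D_def pochhammer_Suc field_simps)
  have step_nz: "of_nat (Suc k) * (of_nat k * a1 + b0) \<noteq> 0" if "Suc k \<le> N" for k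
    using D_nz[OF that] by (auto simp: D_Suc)
  \<comment> \<open>Multiplying the coefficient equation by \<open>D n\<close> makes both sides obey
    the same recurrence. Strong induction is used since it reaches back two indices.\<close>
  have D_coeff: "D k * coeff p k = coeff p 0 * poly (P (int k)) \<tau>0" if "k \<le> N" for k
    using that
  proof (induction k rule: less_induct)
    case (less k)
    show ?case
    proof (cases k)
      case 0
      then show ?thesis using P by (simp add: D_def recurrence_polys_def)
    next
      case (Suc n)
      have IH: "D n * coeff p n = coeff p 0 * poly (P (int n)) \<tau>0"
        using less Suc by simp
      note rec = ode_coeff_recurrence[OF ode, of n]
      note recP = recurrence_polysD[OF P, of n \<tau>0]
      show ?thesis
      proof (cases n)
        case 0
        then show ?thesis
          using rec recP \<open>k = Suc n\<close> P by (simp add: D_Suc D_0 recurrence_polys_def mult_ac)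
      next
        case (Suc m)
        have IH': "D m * coeff p m = coeff p 0 * poly (P (int m)) \<tau>0"
          using less \<open>k = Suc n\<close> Suc by simp
        \<comment> \<open>\<open>A\<close> and \<open>B\<close> are shared by the two recurrences,
          \<open>B\<close> being \<open>\<tau>1 - (n - 1) * b2\<close> with
          \<open>\<tau>1 = N * b2\<close>. \<open>E\<close> is the ratio of \<open>D n\<close> to
          \<open>D m\<close>, which accounts for the extra factor in the recurrence for
          \<open>P\<close>.\<close>
        define A where "A = \<tau>0 - of_nat n * (of_nat n - 1) * a2 - of_nat n * b1"
        define B where "B = b2 * (of_nat N - of_nat n + 1)"
        define E where "E = of_nat n * (of_nat m * a1 + b0)"
        have rec': "of_nat (Suc n) * (of_nat n * a1 + b0) * coeff p (Suc n) =
            A * coeff p n + B * coeff p m"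
          using rec Suc by (simp add: A_def B_def algebra_simps)
        have recP': "poly (P (int (Suc n))) \<tau>0 =
            A * poly (P (int n)) \<tau>0 + B * E * poly (P (int m)) \<tau>0"
          using recP less.prems \<open>k = Suc n\<close> Suc by (simp add: A_def B_def E_def mult_ac)
        have Dn: "D n = E * D m"
          using D_Suc[of m] Suc by (simp add: E_def)
        have "D (Suc n) * coeff p (Suc n) = D n * (A * coeff p n + B * coeff p m)"
          by (simp only: D_Suc flip: rec') (simp only: mult_ac)
        also have "\<dots> = A * (D n * coeff p n) + B * E * (D m * coeff p m)"
          by (simp only: Dn ring_distribs mult_ac)
        also have "\<dots> = coeff p 0 * poly (P (int (Suc n))) \<tau>0"
          by (simp only: IH IH' recP' ring_distribs mult_ac)
        finally show ?thesis
          using \<open>k = Suc n\<close> by simp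
      qed
    qed
  qed
  show ?thesis
    using D_coeff[OF \<open>k \<le> N\<close>] D_nz[OF \<open>k \<le> N\<close>] by (simp add: D_def field_simps)
qed

lemma poly_solution_imp_explicit:
  assumes P: "recurrence_polys a1 a2 b0 b1 b2 N P"
    and a1: "a1 \<noteq> 0"
    and nz: "\<And>k. k \<le> N \<Longrightarrow> pochhammer (b0 / a1) k \<noteq> 0"
    and f: "poly_solution a1 a2 b0 b1 b2 \<tau>0 \<tau>1 N f"
  obtains c where "c \<noteq> 0" "f = (\<lambda>z. c * explicit_solution a1 b0 \<tau>0 N P z)"
proof -
  obtain p where p: "p \<noteq> 0" "degree p = N" "f = poly p"
      "solves_ode a1 a2 b0 b1 b2 \<tau>0 (of_nat N * b2) (poly p)"
    using f degree_condition[OF f] by (auto simp: poly_solution_def poly_fun_of_degree_def)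
  note cf = coeff_poly_solution[OF P a1 nz p(4)]
  \<comment> \<open>Otherwise the formula at \<open>k = N\<close> would annihilate the leading
    coefficient.\<close>
  have "coeff p 0 \<noteq> 0"
    using cf[of N] p(1,2) by auto
  moreover have "f = (\<lambda>z. coeff p 0 * explicit_solution a1 b0 \<tau>0 N P z)"
  proof
    fix z
    have "f z = (\<Sum>k\<le>N. coeff p k * z ^ k)"
      by (simp add: p(3) poly_altdef p(2))
    also have "\<dots> = coeff p 0 * explicit_solution a1 b0 \<tau>0 N P z"
      unfolding explicit_solution_def sum_distrib_left
      by (intro sum.cong refl) (subst cf, simp_all)
    finally show "f z = coeff p 0 * explicit_solution a1 b0 \<tau>0 N P z" .
  qed
  ultimately show ?thesis
    by (rule that)
qed

lemma poly_solution_scale: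
  assumes "poly_solution a1 a2 b0 b1 b2 \<tau>0 \<tau>1 N f" "c \<noteq> 0"
  shows "poly_solution a1 a2 b0 b1 b2 \<tau>0 \<tau>1 N (\<lambda>z. c * f z)"
proof -
  obtain p where p: "p \<noteq> 0" "degree p = N" "f = poly p"
    and ode: "solves_ode a1 a2 b0 b1 b2 \<tau>0 \<tau>1 (poly p)"
    using assms(1) by (auto simp: poly_solution_def poly_fun_of_degree_def)
  have eq: "(\<lambda>z. c * f z) = poly (smult c p)"
    by (simp add: p(3) fun_eq_iff)
  have "solves_ode a1 a2 b0 b1 b2 \<tau>0 \<tau>1 (poly (smult c p))"
    using ode unfolding solves_ode_poly_iff pderiv_smult mult_smult_right
    by (simp only: smult_0_right flip: smult_add_right smult_diff_right)
  then show ?thesis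
    unfolding poly_solution_def poly_fun_of_degree_def eq
    using p(1,2) assms(2) by (auto intro!: exI[of _ "smult c p"])
qed

theorem mainTheorem1:
  fixes a1 a2 b0 b1 b2 \<tau>0 \<tau>1 :: "'a::real_normed_field" and N :: nat
  shows "((\<exists>f. poly_solution a1 a2 b0 b1 b2 \<tau>0 \<tau>1 N f) \<longrightarrow> \<tau>1 = of_nat N * b2)
    \<and> (\<exists>P. recurrence_polys a1 a2 b0 b1 b2 N P)
    \<and> (\<forall>P. recurrence_polys a1 a2 b0 b1 b2 N P
          \<and> a1 \<noteq> 0 \<and> (\<forall>k\<le>N. pochhammer (b0 / a1) k \<noteq> 0)
          \<and> (\<exists>f. poly_solution a1 a2 b0 b1 b2 \<tau>0 \<tau>1 N f)
        \<longrightarrow> (\<forall>f. poly_solution a1 a2 b0 b1 b2 \<tau>0 \<tau>1 N f \<longleftrightarrow>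
              (\<exists>c. c \<noteq> 0 \<and> f = (\<lambda>z. c * explicit_solution a1 b0 \<tau>0 N P z))))"
proof (intro conjI allI impI)
  show "\<tau>1 = of_nat N * b2" if "\<exists>f. poly_solution a1 a2 b0 b1 b2 \<tau>0 \<tau>1 N f"
    using that degree_condition by blast
  show "\<exists>P. recurrence_polys a1 a2 b0 b1 b2 N P"
    by (rule recurrence_polys_exist)
next
  fix P f
  let ?g = "explicit_solution a1 b0 \<tau>0 N P"
  assume asm: "recurrence_polys a1 a2 b0 b1 b2 N P
      \<and> a1 \<noteq> 0 \<and> (\<forall>k\<le>N. pochhammer (b0 / a1) k \<noteq> 0)
      \<and> (\<exists>f. poly_solution a1 a2 b0 b1 b2 \<tau>0 \<tau>1 N f)"
  have explicit: "\<exists>c. c \<noteq> 0 \<and> h = (\<lambda>z. c * ?g z)"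
    if "poly_solution a1 a2 b0 b1 b2 \<tau>0 \<tau>1 N h" for h
    using asm that by (blast elim: poly_solution_imp_explicit)
  \<comment> \<open>The explicit sum is not substituted into the equation: the solution assumed to
    exist is \<open>c0\<close> times it, and rescaling by \<open>c / c0\<close> reaches every other
    nonzero multiple.\<close>
  obtain c0 where c0: "c0 \<noteq> 0" "poly_solution a1 a2 b0 b1 b2 \<tau>0 \<tau>1 N (\<lambda>z. c0 * ?g z)"
    using asm explicit by blast
  have scaled: "poly_solution a1 a2 b0 b1 b2 \<tau>0 \<tau>1 N (\<lambda>z. c * ?g z)" if "c \<noteq> 0" for c
    using poly_solution_scale[OF c0(2), of "c / c0"] c0(1) that by simp
  show "poly_solution a1 a2 b0 b1 b2 \<tau>0 \<tau>1 N f \<longleftrightarrow>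
      (\<exists>c. c \<noteq> 0 \<and> f = (\<lambda>z. c * ?g z))"
    using explicit[of f] by (auto simp: scaled)
qed

end
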